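(* Let $p>1$ and let $f,g,\rho,d$ satisfy the standing assumptions. Assume that the limit $$\ell_1:=\lim_{u\to1^-}\rho(u)\left(\frac{d(u)}{1-u}\right)^{\frac1{p-1}}$$ exists and $\ell_1<+\infty$. Let $u$ be a traveling wave solution, defined in $(\alpha,\beta)$, with some speed $c\ge c^*$. Then: (a) if $\ell_1>0$, then $\alpha>-\infty$ if and only if $\int_{1/2}^1\frac1{\rho(u)}\,du<+\infty$; (b) if $\ell_1=0$ and $cg(1)-f(1)<0$, then $\alpha>-\infty$ if and only if $\int_{1/2}^1\left(\frac{d(u)}{1-u}\right)^{\frac1{p-1}}du<+\infty$; (c) if $\ell_1=0$, $cg(1)-f(1)>0$ and there exist three constants $\delta,\mu,M>0$ and a function $\xi\in C^1([1-\delta,1])$ such that $$\mu\,\xi(u)\le d(u)(\rho(u))^{p-1}\le M\,\xi(u)\quad\text{for every }u\in[1-\delta,1),$$ then $\alpha>-\infty$ if and only if $\int_{1/2}^1\frac1{\rho(u)}\,du<+\infty$; (d) if $\ell_1=cg(1)-f(1)=0$ and there exist $\delta,\mu,M>0$ and $\xi\in C^1([1-\delta,1])$ with $\mu\,\xi(u)\le d(u)(\rho(u))^{p-1}\le M\,\xi(u)$ for every $u\in[1-\delta,1)$, then $\int_{1/2}^1\frac1{\rho(u)}\,du<+\infty$ implies $\alpha>-\infty$.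
   Context: Standing assumptions: $p>1$; $f,g,\rho\in C[0,1]$; $d\in C^1(0,1)$; $\rho(u)>0$ in $(0,1)$ and $\rho(0)=\rho(1)=0$; $g(0)>0$ and $\int_0^u g(s)\,ds>0$ for every $u\in(0,1]$; $d(u)>0$ in $(0,1)$ and $\rho\, d^{\frac1{p-1}}\in L^1(0,1)$. A traveling wave solution (t.w.s.) with speed $c\in\mathbb R$ is a function $u\in C^1(\alpha,\beta)$, with $-\infty\le\alpha<\beta\le+\infty$, such that $0<u(t)<1$ for all $t\in(\alpha,\beta)$, $d(u)|u'|^{p-2}u'\in C^1(\alpha,\beta)$, $$(d(u)|u'|^{p-2}u')'+(cg(u)-f(u))u'+\rho(u)=0\quad\text{in }(\alpha,\beta),$$ $u(\alpha^+)=1$, $u(\beta^-)=0$, and $\lim_{t\to\alpha^+}d(u)|u'|^{p-2}u'=\lim_{t\to\beta^-}d(u)|u'|^{p-2}u'=0$. $c^*$ denotes the minimal admissible wave speed, i.e. the infimum of all $c$ for which a t.w.s. with speed $c$ exists (so every t.w.s. has speed $c\ge c^*$). *)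

theory Defs
  imports "HOL-Analysis.Analysis"
begin

definition standing_assumptions ::
  "real \<Rightarrow> (real \<Rightarrow> real) \<Rightarrow> (real \<Rightarrow> real) \<Rightarrow> (real \<Rightarrow> real) \<Rightarrow> (real \<Rightarrow> real) \<Rightarrow> bool"
  where "standing_assumptions p f g \<rho> d \<longleftrightarrow>
    p > 1 \<and>
    continuous_on {0..1} f \<and> continuous_on {0..1} g \<and> continuous_on {0..1} \<rho> \<and>
    d C1_differentiable_on {0<..<1} \<and>
    (\<forall>u\<in>{0<..<1}. \<rho> u > 0) \<and> \<rho> 0 = 0 \<and> \<rho> 1 = 0 \<and>
    g 0 > 0 \<and> (\<forall>u\<in>{0<..1}. integral {0..u} g > 0) \<and>
    (\<forall>u\<in>{0<..<1}. d u > 0) \<and>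
    set_integrable lborel {0<..<1} (\<lambda>u. \<rho> u * d u powr (1 / (p - 1)))"

(* At a zero of u' the value is 0, for every p > 1, also where |u'|^(p - 2) is singular. *)
definition flux :: "real \<Rightarrow> (real \<Rightarrow> real) \<Rightarrow> (real \<Rightarrow> real) \<Rightarrow> real \<Rightarrow> real"
  where "flux p d u t = d (u t) * \<bar>deriv u t\<bar> powr (p - 2) * deriv u t"

(* The endpoints are extended reals: einterval \<alpha> \<beta> is the set of reals strictly between them,
   and a limit at an infinite endpoint is a limit at infinity. *)
definition travelling_wave ::
  "real \<Rightarrow> (real \<Rightarrow> real) \<Rightarrow> (real \<Rightarrow> real) \<Rightarrow> (real \<Rightarrow> real) \<Rightarrow> (real \<Rightarrow> real) \<Rightarrow>
    real \<Rightarrow> ereal \<Rightarrow> ereal \<Rightarrow> (real \<Rightarrow> real) \<Rightarrow> bool"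
  where "travelling_wave p f g \<rho> d c \<alpha> \<beta> u \<longleftrightarrow>
    \<alpha> < \<beta> \<and>
    u C1_differentiable_on einterval \<alpha> \<beta> \<and>
    (\<forall>t\<in>einterval \<alpha> \<beta>. 0 < u t \<and> u t < 1) \<and>
    flux p d u C1_differentiable_on einterval \<alpha> \<beta> \<and>
    (\<forall>t\<in>einterval \<alpha> \<beta>.
      deriv (flux p d u) t + (c * g (u t) - f (u t)) * deriv u t + \<rho> (u t) = 0) \<and>
    ((u \<circ> real_of_ereal) \<longlongrightarrow> 1) (at_right \<alpha>) \<and>
    ((u \<circ> real_of_ereal) \<longlongrightarrow> 0) (at_left \<beta>) \<and>
    ((flux p d u \<circ> real_of_ereal) \<longlongrightarrow> 0) (at_right \<alpha>) \<and>
    ((flux p d u \<circ> real_of_ereal) \<longlongrightarrow> 0) (at_left \<beta>)"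

(* Taken in the extended reals, so that it is the true infimum with no a priori
   nonemptiness or boundedness of the set of speeds. *)
definition minimal_speed ::
  "real \<Rightarrow> (real \<Rightarrow> real) \<Rightarrow> (real \<Rightarrow> real) \<Rightarrow> (real \<Rightarrow> real) \<Rightarrow> (real \<Rightarrow> real) \<Rightarrow> ereal"
  where "minimal_speed p f g \<rho> d =
    Inf (ereal ` {c. \<exists>\<alpha> \<beta> u. travelling_wave p f g \<rho> d c \<alpha> \<beta> u})"

(* Unlike C1_differentiable_on, one-sided derivatives at the endpoints, so that values
   outside the interval are irrelevant. *)
definition C1_on_closed_interval :: "real \<Rightarrow> real \<Rightarrow> (real \<Rightarrow> real) \<Rightarrow> bool"
  where "C1_on_closed_interval a b \<xi> \<longleftrightarrow>
    (\<exists>\<xi>'. continuous_on {a..b} \<xi>' \<and>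
      (\<forall>x\<in>{a..b}. (\<xi> has_real_derivative \<xi>' x) (at x within {a..b})))"

(* The bound \<delta> < 1 keeps [1 - \<delta>, 1) inside (0, 1), where d is defined. *)
definition C1_comparable_near_1 ::
  "real \<Rightarrow> (real \<Rightarrow> real) \<Rightarrow> (real \<Rightarrow> real) \<Rightarrow> bool"
  where "C1_comparable_near_1 p \<rho> d \<longleftrightarrow>
    (\<exists>\<delta> \<mu> M \<xi>. 0 < \<delta> \<and> \<delta> < 1 \<and> 0 < \<mu> \<and> 0 < M \<and>
      C1_on_closed_interval (1 - \<delta>) 1 \<xi> \<and>
      (\<forall>u\<in>{1 - \<delta>..<1}.
        \<mu> * \<xi> u \<le> d u * \<rho> u powr (p - 1) \<and> d u * \<rho> u powr (p - 1) \<le> M * \<xi> u))"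

end

theory Submission
  imports Defs
begin

text \<open>
  The flux decreases at each of its zeros, so a zero would make the wave increase near \<open>\<alpha>\<close>, against
  \<open>u(\<alpha>+) = 1\<close>; hence \<open>u' < 0\<close> and \<open>w = d(u)|u'|^(p-1)\<close> is positive. With \<open>h = cg - f\<close> and
  \<open>\<phi> = d \<rho>^(p-1)\<close> the wave equation reads \<open>w' = |u'| ((\<phi>(u)/w)^(1/(p-1)) - h(u))\<close>, which yields a
  comparison principle between \<open>w\<close> and \<open>B(u)\<close> as \<open>t\<close> decreases to \<open>\<alpha>\<close>. Barriers \<open>B\<close> that are constant
  multiples of \<open>1 - v\<close> or of \<open>\<xi>\<close> pin \<open>w\<close> down up to constants. As \<open>|u'| = (w/d(u))^(1/(p-1))\<close>, this
  bounds \<open>k(u)|u'|\<close> for the integrand \<open>k\<close> of each criterion, and substituting \<open>v = u(t)\<close> compares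
  the length of the time interval near \<open>\<alpha>\<close> with the integral of \<open>k\<close>.
\<close>

section \<open>Derivatives of C1 functions and the filter at the left end\<close>

lemma C1_differentiable_on_deriv:
  fixes f :: "real \<Rightarrow> real"
  assumes "f C1_differentiable_on S"
  shows "\<And>x. x \<in> S \<Longrightarrow> (f has_real_derivative deriv f x) (at x)"
    and "continuous_on S (deriv f)"
proof -
  obtain D where D: "\<And>x. x \<in> S \<Longrightarrow> (f has_real_derivative D x) (at x)" and "continuous_on S D"
    using assms unfolding C1_differentiable_on_def has_real_derivative_iff_has_vector_derivative
    by blast
  moreover have "deriv f x = D x" if "x \<in> S" for x
    using D[OF that] by (rule DERIV_imp_deriv)
  ultimately show "\<And>x. x \<in> S \<Longrightarrow> (f has_real_derivative deriv f x) (at x)"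
    and "continuous_on S (deriv f)"
    by (auto cong: continuous_on_cong)
qed

text \<open>This is \<open>at_right a\<close> if \<open>\<alpha> = ereal a\<close>, and \<open>at_bot\<close> if \<open>\<alpha> = -\<infinity>\<close>.\<close>

abbreviation at_left_end :: "ereal \<Rightarrow> real filter"
  where "at_left_end \<alpha> \<equiv> filtermap real_of_ereal (at_right \<alpha>)"

text \<open>The bound \<open>ereal b < \<beta>\<close> costs nothing, because the reals are dense in
  \<open>ereal\<close> and \<open>b\<close> may be lowered. It places every admissible
  \<open>t\<close> inside the interval of the wave, and lets finite and infinite left ends be
  handled alike.\<close>

lemma eventually_at_left_end:
  assumes "\<alpha> < \<beta>"
  shows "eventually P (at_left_end \<alpha>) \<longleftrightarrow>
    (\<exists>b. \<alpha> < ereal b \<and> ereal b < \<beta> \<and> (\<forall>t. \<alpha> < ereal t \<longrightarrow> t < b \<longrightarrow> P t))"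
proof
  assume "eventually P (at_left_end \<alpha>)"
  then obtain b' where b': "b' > \<alpha>" "\<And>y. y > \<alpha> \<Longrightarrow> y < b' \<Longrightarrow> P (real_of_ereal y)"
    unfolding eventually_filtermap eventually_at_right[OF assms] by blast
  obtain b where b: "\<alpha> < ereal b" "ereal b < min b' \<beta>"
    using ereal_dense2[of \<alpha> "min b' \<beta>"] b' assms by auto
  have "P t" if "\<alpha> < ereal t" "t < b" for t
  proof -
    have "ereal t < b'"
      using that b by (metis ereal_less_le less_ereal.simps(1) less_imp_le min_less_iff_conj)
    then show ?thesis using b'(2)[of "ereal t"] that by simp
  qed
  with b show "\<exists>b. \<alpha> < ereal b \<and> ereal b < \<beta> \<and> (\<forall>t. \<alpha> < ereal t \<longrightarrow> t < b \<longrightarrow> P t)" by auto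
next
  assume "\<exists>b. \<alpha> < ereal b \<and> ereal b < \<beta> \<and> (\<forall>t. \<alpha> < ereal t \<longrightarrow> t < b \<longrightarrow> P t)"
  then obtain b where b: "\<alpha> < ereal b" "\<And>t. \<alpha> < ereal t \<Longrightarrow> t < b \<Longrightarrow> P t" by auto
  have "P (real_of_ereal y)" if "y > \<alpha>" "y < ereal b" for y
    using that b(2) by (cases y) auto
  with b(1) show "eventually P (at_left_end \<alpha>)"
    unfolding eventually_filtermap eventually_at_right[OF assms] by blast
qed

lemma at_left_end_neq_bot:
  assumes "\<alpha> < \<beta>"
  shows "at_left_end \<alpha> \<noteq> bot"
proof
  assume "at_left_end \<alpha> = bot"
  then have "eventually (\<lambda>_. False) (at_left_end \<alpha>)" by simp
  then obtain b where "\<alpha> < ereal b" "\<And>t. \<alpha> < ereal t \<Longrightarrow> t < b \<Longrightarrow> False"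
    unfolding eventually_at_left_end[OF assms] by auto
  then show False using ereal_dense2[of \<alpha> "ereal b"] by auto
qed

section \<open>Sign propagation for functions of one real variable\<close>

text \<open>If \<open>F t > 0\<close>, a maximum of \<open>F\<close> over \<open>{s..t}\<close> can
  sit only at \<open>s\<close>: at any other maximiser \<open>F\<close> is positive, hence has a
  negative derivative and is larger slightly to the left. So \<open>F\<close> stays at least
  \<open>F t\<close> on the way to \<alpha>, against the limit 0.\<close>

lemma nonpos_at_left_end:
  fixes F F' :: "real \<Rightarrow> real"
  assumes "\<alpha> < \<beta>"
    and lim: "(F \<longlongrightarrow> 0) (at_left_end \<alpha>)"
    and dec: "eventually (\<lambda>t. (F has_real_derivative F' t) (at t) \<and> (F t > 0 \<longrightarrow> F' t < 0)) (at_left_end \<alpha>)"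
  shows "eventually (\<lambda>t. F t \<le> 0) (at_left_end \<alpha>)"
proof -
  obtain b where b: "\<alpha> < ereal b" "ereal b < \<beta>"
    "\<And>t. \<alpha> < ereal t \<Longrightarrow> t < b \<Longrightarrow> F t > 0 \<Longrightarrow> F' t < 0"
    "\<And>t. \<alpha> < ereal t \<Longrightarrow> t < b \<Longrightarrow> (F has_real_derivative F' t) (at t)"
    using dec unfolding eventually_at_left_end[OF \<open>\<alpha> < \<beta>\<close>] by auto
  have "F t \<le> 0" if t: "\<alpha> < ereal t" "t < b" for t
  proof (rule ccontr)
    assume "\<not> F t \<le> 0"
    then have pos: "F t > 0" by simp
    have "F t \<le> F s" if s: "\<alpha> < ereal s" "s < t" for s
    proof -
      have sub: "\<alpha> < ereal x" "x < b" if "x \<in> {s..t}" for x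
      proof -
        show "\<alpha> < ereal x" using s that by (meson atLeastAtMost_iff ereal_less_eq(3) less_le_trans)
        show "x < b" using t that by simp
      qed
      have "continuous_on {s..t} F"
        by (intro continuous_at_imp_continuous_on ballI DERIV_isCont[OF b(4)] sub)
      then obtain m where m: "m \<in> {s..t}" "\<And>x. x \<in> {s..t} \<Longrightarrow> F x \<le> F m"
        using continuous_attains_sup[of "{s..t}" F] s by auto
      have "m = s"
      proof (rule ccontr)
        assume "m \<noteq> s"
        have "F m > 0" using m(2)[of t] pos s by auto
        then have "F' m < 0" using b(3) sub m(1) by blast
        then obtain e where e: "e > 0" "\<And>h. h > 0 \<Longrightarrow> h < e \<Longrightarrow> F m < F (m - h)"
          using DERIV_neg_dec_left[OF b(4)[OF sub[OF m(1)]]] by blast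
        define h where "h = min (e / 2) (m - s)"
        have "h > 0" "h < e" "m - h \<in> {s..t}"
          using e(1) m(1) \<open>m \<noteq> s\<close> by (auto simp: h_def)
        with e(2)[of h] m(2)[of "m - h"] show False by auto
      qed
      with m(2)[of t] s show ?thesis by simp
    qed
    then have "eventually (\<lambda>s. F t \<le> F s) (at_left_end \<alpha>)"
      unfolding eventually_at_left_end[OF \<open>\<alpha> < \<beta>\<close>] using t b(2)
      by (metis less_ereal.simps(1) order_less_trans)
    from tendsto_lowerbound[OF lim this at_left_end_neq_bot[OF \<open>\<alpha> < \<beta>\<close>]] pos
    show False by simp
  qed
  with b show ?thesis unfolding eventually_at_left_end[OF \<open>\<alpha> < \<beta>\<close>] by blast
qed

text \<open>Zeros are crossed only downwards. If \<open>F s\<close> were not positive, the last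
  point of \<open>{s..t'}\<close> with \<open>F \<le> 0\<close> would be a zero, and
  \<open>F\<close> would be negative just after it.\<close>

lemma pos_before_nonneg:
  fixes F F' :: "real \<Rightarrow> real"
  assumes deriv: "\<And>x. x \<in> {s..t} \<Longrightarrow> (F has_real_derivative F' x) (at x)"
    and neg: "\<And>x. x \<in> {s..t} \<Longrightarrow> F x = 0 \<Longrightarrow> F' x < 0"
    and "s < t" "F t \<ge> 0"
  shows "F s > 0"
proof (rule ccontr)
  assume "\<not> F s > 0"
  then have Fs: "F s \<le> 0" by simp
  \<comment> \<open>\<open>t\<close> itself may be a zero; then a point slightly to its left has a
    positive value and replaces \<open>t\<close>.\<close>
  obtain t' where t': "s < t'" "t' \<le> t" "F t' > 0"
  proof (cases "F t = 0")
    case True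
    then obtain e where e: "e > 0" "\<And>h. h > 0 \<Longrightarrow> h < e \<Longrightarrow> F t < F (t - h)"
      using DERIV_neg_dec_left[OF deriv[of t] neg[of t]] \<open>s < t\<close> by auto
    define h where "h = min (e / 2) ((t - s) / 2)"
    have "h > 0" "h < e" "s < t - h" using e(1) \<open>s < t\<close> by (auto simp: h_def min_def field_simps)
    with e(2)[of h] True that[of "t - h"] show thesis by auto
  next
    case False
    with \<open>F t \<ge> 0\<close> \<open>s < t\<close> that[of t] show thesis by auto
  qed
  have contF: "continuous_on {s..t'} F"
    using t' by (intro continuous_at_imp_continuous_on ballI DERIV_isCont[OF deriv]) auto
  define Z where "Z = {x \<in> {s..t'}. F x \<le> 0}"
  have "closed Z"
    unfolding Z_def by (intro continuous_on_closed_Collect_le contF) auto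
  moreover have "bounded Z"
    by (rule bounded_subset[of "{s..t'}"]) (auto simp: Z_def)
  ultimately have "compact Z" by (simp add: compact_eq_bounded_closed)
  moreover have "s \<in> Z" using t' Fs by (simp add: Z_def)
  ultimately obtain r where r: "r \<in> Z" "\<And>x. x \<in> Z \<Longrightarrow> x \<le> r"
    using continuous_attains_sup[of Z "\<lambda>x. x"] by auto
  have rt: "s \<le> r" "r < t'" "F r \<le> 0" using r(1) t' by (auto simp: Z_def order.order_iff_strict)
  have "\<exists>x\<ge>r. x \<le> t' \<and> F x = 0"
    using rt t' by (intro IVT') (auto intro: continuous_on_subset[OF contF])
  then obtain x where x: "x \<ge> r" "x \<le> t'" "F x = 0" by auto
  then have "x = r" using r(2)[of x] rt by (simp add: Z_def)
  then have "F r = 0" using x by simp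
  then obtain e where e: "e > 0" "\<And>h. h > 0 \<Longrightarrow> h < e \<Longrightarrow> F (r + h) < F r"
    using DERIV_neg_dec_right[OF deriv[of r] neg[of r]] rt t' by auto
  define h where "h = min (e / 2) (t' - r)"
  have h: "h > 0" "h < e" "r + h \<le> t'" using e(1) rt by (auto simp: h_def)
  then have "r + h \<in> Z" using e(2)[of h] \<open>F r = 0\<close> rt by (simp add: Z_def)
  with r(2) h show False by force
qed

section \<open>Integrals up to the endpoint 1\<close>

text \<open>Continuity from below of the measure with density \<open>k\<close> carries the uniform
  bound from \<open>{a..b}\<close> to \<open>{a..<1}\<close>. The remaining piece is compact, and
  \<open>k\<close> is bounded there.\<close>

lemma nn_integral_left_at_1_finite:
  fixes k :: "real \<Rightarrow> real"
  assumes cont: "continuous_on {0<..<1} k"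
    and a: "0 < a" "a < 1" and C: "C < \<infinity>"
    and bound: "\<And>b. a < b \<Longrightarrow> b < 1 \<Longrightarrow> (\<integral>\<^sup>+v\<in>{a..b}. ennreal (k v) \<partial>lborel) \<le> C"
  shows "(\<integral>\<^sup>+v\<in>{1/2<..<1}. ennreal (k v) \<partial>lborel) < \<infinity>"
proof -
  define K where "K v = ennreal (indicator {0<..<1} v *\<^sub>R k v)" for v
  have [measurable]: "K \<in> borel_measurable lborel"
    unfolding K_def using borel_measurable_continuous_on_indicator[OF _ cont] by simp
  define \<nu> where "\<nu> = density lborel K"
  have \<nu>: "emeasure \<nu> A = (\<integral>\<^sup>+v\<in>A. ennreal (k v) \<partial>lborel)"
    if "A \<subseteq> {0<..<1}" "A \<in> sets borel" for A
    using that unfolding \<nu>_def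
    by (subst emeasure_density) (auto simp: K_def indicator_def intro!: nn_integral_cong)
  \<comment> \<open>The points \<open>b n\<close> increase to 1; the shift by 2 gives
    \<open>b 0 > a\<close>.\<close>
  define b where "b n = 1 - (1 - a) / real (n + 2)" for n
  have b: "a < b n" "b n < 1" for n
    using a mult_strict_right_mono[of "1" "real (n + 2)" "1 - a"] by (auto simp: b_def field_simps)
  have "{a..<1} \<subseteq> (\<Union>n. {a..b n})"
  proof
    fix x assume x: "x \<in> {a..<1}"
    have "b \<longlonglongrightarrow> 1 - 0"
      unfolding b_def by (intro tendsto_diff tendsto_const LIMSEQ_ignore_initial_segment[OF lim_const_over_n])
    then have "eventually (\<lambda>n. b n > x) sequentially"
      using x by (intro order_tendstoD(1)[where y = 1]) auto
    then obtain n where "b n > x" by (auto simp: eventually_sequentially)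
    with x show "x \<in> (\<Union>n. {a..b n})" by (auto intro!: exI[of _ n])
  qed
  moreover have "(\<Union>n. {a..b n}) \<subseteq> {a..<1}"
    using b(2) by clarsimp (meson le_less_trans)
  ultimately have "{a..<1} = (\<Union>n. {a..b n})" by (rule subset_antisym)
  moreover have "incseq (\<lambda>n. {a..b n})"
    unfolding incseq_def b_def using a by (auto intro: order_trans intro!: divide_left_mono)
  then have "(SUP n. emeasure \<nu> {a..b n}) = emeasure \<nu> (\<Union>n. {a..b n})"
    by (intro SUP_emeasure_incseq) (auto simp: \<nu>_def)
  moreover have "emeasure \<nu> {a..b n} \<le> C" for n
    using bound[OF b] a b[of n] by (subst \<nu>) auto
  then have "(SUP n. emeasure \<nu> {a..b n}) \<le> C" by (intro SUP_least)
  ultimately have right: "emeasure \<nu> {a..<1} \<le> C" by simp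
  \<comment> \<open>If \<open>a < 1/2\<close>, this compact piece is empty and
    \<open>{a..<1}\<close> alone covers the range of integration.\<close>
  have cont': "continuous_on {1/2..a} k"
    using a by (intro continuous_on_subset[OF cont]) auto
  then obtain B where B: "\<And>v. v \<in> {1/2..a} \<Longrightarrow> k v \<le> B"
    using compact_imp_bounded[OF compact_continuous_image[OF cont']]
    unfolding bounded_iff by (fastforce simp: abs_le_iff)
  have "emeasure \<nu> {1/2..a} = (\<integral>\<^sup>+v\<in>{1/2..a}. ennreal (k v) \<partial>lborel)"
    using a by (intro \<nu>) auto
  also have "\<dots> \<le> (\<integral>\<^sup>+v\<in>{1/2..a}. ennreal B \<partial>lborel)"
    using B by (intro nn_integral_mono) (auto simp: indicator_def intro!: ennreal_leI)
  also have "\<dots> < \<infinity>" by (simp add: nn_integral_cmult_indicator emeasure_lborel_Icc_eq ennreal_mult_less_top)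
  finally have left: "emeasure \<nu> {1/2..a} < \<infinity>" .
  have "(\<integral>\<^sup>+v\<in>{1/2<..<1}. ennreal (k v) \<partial>lborel) = emeasure \<nu> {1/2<..<1}"
    by (subst \<nu>) auto
  also have "\<dots> \<le> emeasure \<nu> ({1/2..a} \<union> {a..<1})"
    by (intro emeasure_mono) (auto simp: \<nu>_def)
  also have "\<dots> \<le> emeasure \<nu> {1/2..a} + emeasure \<nu> {a..<1}"
    by (intro emeasure_subadditive) (auto simp: \<nu>_def)
  also have "\<dots> < \<infinity>" using left right C by (auto simp: less_top[symmetric] top_unique)
  finally show ?thesis .
qed

section \<open>Decreasing profiles and the substitution v = u(t)\<close>

locale decreasing_profile =
  fixes \<alpha> \<beta> :: ereal and u u' :: "real \<Rightarrow> real"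
  assumes ends: "\<alpha> < \<beta>"
    and u_deriv: "\<And>t. t \<in> einterval \<alpha> \<beta> \<Longrightarrow> (u has_real_derivative u' t) (at t)"
    and u'_cont: "continuous_on (einterval \<alpha> \<beta>) u'"
    and u_range: "\<And>t. t \<in> einterval \<alpha> \<beta> \<Longrightarrow> u t \<in> {0<..<1}"
    and u'_neg: "\<And>t. t \<in> einterval \<alpha> \<beta> \<Longrightarrow> u' t < 0"
    and u_lim: "(u \<longlongrightarrow> 1) (at_left_end \<alpha>)"
begin

lemma eventually_in_domain: "eventually (\<lambda>t. t \<in> einterval \<alpha> \<beta>) (at_left_end \<alpha>)"
proof -
  obtain b where b: "\<alpha> < ereal b" "ereal b < \<beta>" using ereal_dense2[OF ends] by auto
  have "t \<in> einterval \<alpha> \<beta>" if "\<alpha> < ereal t" "t < b" for t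
  proof -
    have "ereal t < \<beta>" using that b(2) by (meson less_ereal.simps(1) less_trans)
    with that show ?thesis by (simp add: einterval_def)
  qed
  with b show ?thesis unfolding eventually_at_left_end[OF ends] by blast
qed

lemma u_at_left: "filterlim u (at_left 1) (at_left_end \<alpha>)"
  unfolding filterlim_at
proof
  show "eventually (\<lambda>t. u t \<in> {..<1} \<and> u t \<noteq> 1) (at_left_end \<alpha>)"
    using eventually_in_domain by (rule eventually_mono) (use u_range in force)
qed (rule u_lim)

lemma eventually_left_1:
  assumes "eventually P (at_left 1)"
  shows "eventually (\<lambda>t. P (u t)) (at_left_end \<alpha>)"
  using assms u_at_left by (rule eventually_compose_filterlim)

lemma obtain_initial:
  assumes "eventually P (at_left_end \<alpha>)"
  obtains s where "\<alpha> < ereal s"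
    "\<And>t. \<alpha> < ereal t \<Longrightarrow> t \<le> s \<Longrightarrow> P t" "\<And>t. \<alpha> < ereal t \<Longrightarrow> t \<le> s \<Longrightarrow> t \<in> einterval \<alpha> \<beta>"
proof -
  have "eventually (\<lambda>t. P t \<and> t \<in> einterval \<alpha> \<beta>) (at_left_end \<alpha>)"
    using assms eventually_in_domain by (rule eventually_conj)
  then obtain b where b: "\<alpha> < ereal b"
    "\<And>t. \<alpha> < ereal t \<Longrightarrow> t < b \<Longrightarrow> P t \<and> t \<in> einterval \<alpha> \<beta>"
    unfolding eventually_at_left_end[OF ends] by auto
  obtain s where s: "\<alpha> < ereal s" "ereal s < ereal b" using ereal_dense2[OF b(1)] by auto
  show thesis using b(2) s by (intro that[of s]) auto
qed

lemma nn_integral_profile: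
  fixes k :: "real \<Rightarrow> real"
  assumes cont: "continuous_on {0<..<1} k"
    and dom: "\<And>x. x \<in> {t..s} \<Longrightarrow> x \<in> einterval \<alpha> \<beta>" and "t \<le> s"
  shows "(\<integral>\<^sup>+v\<in>{u s..u t}. ennreal (k v) \<partial>lborel) =
    (\<integral>\<^sup>+x\<in>{-s..-t}. ennreal (k (u (-x)) * - u' (-x)) \<partial>lborel)"
proof -
  \<comment> \<open>the library substitution rule needs a nondecreasing map, hence \<open>x \<mapsto> u (-x)\<close>\<close>
  have range: "u s \<in> {0<..<1}" "u t \<in> {0<..<1}" using dom \<open>t \<le> s\<close> by (auto intro!: u_range simp del: greaterThanLessThan_iff)
  have cont': "continuous_on {u s..u t} k"
    using range by (intro continuous_on_subset[OF cont]) auto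
  have "(\<integral>\<^sup>+v\<in>{u s..u t}. ennreal (k v) \<partial>lborel) =
    (\<integral>\<^sup>+v. ennreal (k v) * indicator {u (-(-s))..u (-(-t))} v \<partial>lborel)" by simp
  also have "\<dots> = (\<integral>\<^sup>+v. ennreal (k v * indicator {u (-(-s))..u (-(-t))} v) \<partial>lborel)"
    by (intro nn_integral_cong) (auto simp: indicator_def)
  also have "\<dots> =
    (\<integral>\<^sup>+x. ennreal (k (u (-x)) * - u' (-x) * indicator {-s..-t} x) \<partial>lborel)"
  proof (rule nn_integral_substitution)
    show "set_borel_measurable borel {u (- (- s))..u (- (- t))} k"
      unfolding set_borel_measurable_def
      using borel_measurable_continuous_on_indicator[OF _ cont'] by simp
    show "((\<lambda>x. u (- x)) has_real_derivative - u' (- x)) (at x)" if "x \<in> {-s..-t}" for x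
    proof -
      have "(u has_real_derivative u' (-x)) (at (-x))" using that dom by (intro u_deriv) auto
      from DERIV_chain2[where g = uminus and x = x, OF this, of "-1"] show ?thesis
        by (simp add: DERIV_minus[OF DERIV_ident, of x UNIV])
    qed
    show "continuous_on {-s..-t} (\<lambda>x. - u' (- x))"
      using dom by (intro continuous_on_minus continuous_on_compose2[OF u'_cont]) (auto intro!: continuous_intros)
    show "- u' (- x) \<ge> 0" if "x \<in> {-s..-t}" for x
      using u'_neg[OF dom, of "-x"] that by simp
  qed (use \<open>t \<le> s\<close> in simp)
  also have "\<dots> = (\<integral>\<^sup>+x\<in>{-s..-t}. ennreal (k (u (-x)) * - u' (-x)) \<partial>lborel)"
    by (intro nn_integral_cong) (auto simp: indicator_def)
  finally show ?thesis .
qed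

text \<open>By substitution, the integral of \<open>k\<close> over the values taken on
  \<open>{t..s}\<close> is at least \<open>C * (s - t)\<close>. Were \<alpha> infinite,
  \<open>s - t\<close> could be made arbitrarily large.\<close>

lemma left_end_finite:
  fixes k :: "real \<Rightarrow> real"
  assumes cont: "continuous_on {0<..<1} k"
    and C: "C > 0" and lower: "eventually (\<lambda>t. C \<le> k (u t) * - u' t) (at_left_end \<alpha>)"
    and fin: "(\<integral>\<^sup>+v\<in>{1/2<..<1}. ennreal (k v) \<partial>lborel) < \<infinity>"
  shows "\<alpha> > -\<infinity>"
proof (rule ccontr)
  assume "\<not> \<alpha> > -\<infinity>"
  then have \<alpha>: "\<alpha> = -\<infinity>" by simp
  have "eventually (\<lambda>t. C \<le> k (u t) * - u' t \<and> u t > 1/2) (at_left_end \<alpha>)"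
    by (intro eventually_conj lower order_tendstoD(1)[OF u_lim]) auto
  then obtain s where s: "\<And>t. t \<le> s \<Longrightarrow> C \<le> k (u t) * - u' t" "\<And>t. t \<le> s \<Longrightarrow> u t > 1/2"
    "\<And>t. t \<le> s \<Longrightarrow> t \<in> einterval \<alpha> \<beta>"
    by (rule obtain_initial) (auto simp: \<alpha>)
  obtain I where I: "I \<ge> 0" "(\<integral>\<^sup>+v\<in>{1/2<..<1}. ennreal (k v) \<partial>lborel) = ennreal I"
    using fin by (metis ennreal_cases infinity_ennreal_def less_irrefl)
  \<comment> \<open>This length makes \<open>C * (s - t)\<close> equal to \<open>I + 1\<close>,
    which exceeds the whole integral \<open>I\<close>.\<close>
  define t where "t = s - (I + 1) / C"
  have "t \<le> s" using C I by (simp add: t_def)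
  have "ennreal (I + 1) = ennreal C * ennreal (s - t)"
    using C I by (subst ennreal_mult[symmetric]) (auto simp: t_def)
  also have "\<dots> = (\<integral>\<^sup>+x\<in>{-s..-t}. ennreal C \<partial>lborel)"
    using \<open>t \<le> s\<close> by (simp add: nn_integral_cmult_indicator)
  also have "\<dots> \<le> (\<integral>\<^sup>+x\<in>{-s..-t}. ennreal (k (u (-x)) * - u' (-x)) \<partial>lborel)"
    using s(1)[of "- x" for x] by (intro nn_integral_mono) (auto simp: indicator_def intro!: ennreal_leI)
  also have "\<dots> = (\<integral>\<^sup>+v\<in>{u s..u t}. ennreal (k v) \<partial>lborel)"
    using s \<open>t \<le> s\<close> by (intro nn_integral_profile[symmetric] cont) auto
  also have "\<dots> \<le> (\<integral>\<^sup>+v\<in>{1/2<..<1}. ennreal (k v) \<partial>lborel)"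
    using s(2)[of s] u_range[OF s(3)[OF \<open>t \<le> s\<close>]] by (intro nn_integral_mono) (auto simp: indicator_def)
  also note I(2)
  finally show False using I by simp
qed

text \<open>The converse estimate: time from \<alpha> to \<open>s\<close> is now bounded, so
  substitution bounds the integral of \<open>k\<close> from \<open>u s\<close> to any
  \<open>b < 1\<close> by \<open>ennreal C * ennreal (s - a)\<close>, uniformly in
  \<open>b\<close>.\<close>

lemma nn_integral_finite:
  fixes k :: "real \<Rightarrow> real"
  assumes cont: "continuous_on {0<..<1} k"
    and upper: "eventually (\<lambda>t. k (u t) * - u' t \<le> C) (at_left_end \<alpha>)"
    and "\<alpha> > -\<infinity>"
  shows "(\<integral>\<^sup>+v\<in>{1/2<..<1}. ennreal (k v) \<partial>lborel) < \<infinity>"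
proof -
  obtain a where a: "\<alpha> = ereal a" using ends \<open>\<alpha> > -\<infinity>\<close> by (cases \<alpha>) auto
  obtain s where s: "a < s" "\<And>t. a < t \<Longrightarrow> t \<le> s \<Longrightarrow> k (u t) * - u' t \<le> C"
    "\<And>t. a < t \<Longrightarrow> t \<le> s \<Longrightarrow> t \<in> einterval \<alpha> \<beta>"
    by (rule obtain_initial[OF upper]) (auto simp: a)
  show ?thesis
  proof (rule nn_integral_left_at_1_finite[OF cont])
    show "0 < u s" "u s < 1" using u_range[OF s(3)[of s]] s(1) by auto
    show "ennreal C * ennreal (s - a) < \<infinity>" by (simp add: ennreal_mult_less_top)
    fix b assume b: "u s < b" "b < 1"
    have "eventually (\<lambda>t. u t > b \<and> t < s) (at_left_end \<alpha>)"
    proof (intro eventually_conj)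
      show "eventually (\<lambda>t. u t > b) (at_left_end \<alpha>)"
        using u_lim b(2) by (rule order_tendstoD(1))
      show "eventually (\<lambda>t. t < s) (at_left_end \<alpha>)"
        using s(1) s(3)[of s] unfolding eventually_at_left_end[OF ends]
        by (intro exI[of _ s]) (auto simp: a einterval_def)
    qed
    then obtain t where t: "a < t" "t < s" "u t > b"
      by (rule obtain_initial) (auto simp: a)
    have "(\<integral>\<^sup>+v\<in>{u s..b}. ennreal (k v) \<partial>lborel) \<le> (\<integral>\<^sup>+v\<in>{u s..u t}. ennreal (k v) \<partial>lborel)"
      using t by (intro nn_integral_mono) (auto simp: indicator_def)
    also have "\<dots> = (\<integral>\<^sup>+x\<in>{-s..-t}. ennreal (k (u (-x)) * - u' (-x)) \<partial>lborel)"
      using s t by (intro nn_integral_profile cont) auto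
    also have "\<dots> \<le> (\<integral>\<^sup>+x\<in>{-s..-t}. ennreal C \<partial>lborel)"
      using s(2)[of "- x" for x] t by (intro nn_integral_mono) (auto simp: indicator_def intro!: ennreal_leI)
    also have "\<dots> = ennreal C * ennreal (s - t)"
      using t by (simp add: nn_integral_cmult_indicator)
    also have "\<dots> \<le> ennreal C * ennreal (s - a)"
      using t by (intro mult_left_mono ennreal_leI) auto
    finally show "(\<integral>\<^sup>+v\<in>{u s..b}. ennreal (k v) \<partial>lborel) \<le> ennreal C * ennreal (s - a)" .
  qed
qed

end

section \<open>The first-order equation for w and the comparison principle\<close>

text \<open>\<open>k powr - q\<close> blows up as \<open>k\<close> decreases to 0. The witness
  solves \<open>k powr - q = max A 1\<close>, and the maximum with 1 keeps it at most 1.\<close>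

lemma powr_neg_unbounded:
  fixes A q :: real
  assumes "q > 0"
  obtains k where "0 < k" "k \<le> 1" "A \<le> k powr - q"
proof (rule that)
  define B where "B = max A 1"
  show "0 < B powr - (1 / q)" by (simp add: B_def)
  have "B powr - (1 / q) \<le> B powr 0"
    using assms by (intro powr_mono) (auto simp: B_def)
  moreover have "B > 0" by (simp add: B_def)
  ultimately show "B powr - (1 / q) \<le> 1" by simp
  show "A \<le> (B powr - (1 / q)) powr - q"
    using assms by (simp add: powr_powr B_def)
qed

text \<open>\<open>w\<close> stands for minus the flux and \<open>h\<close> for
  \<open>c * g - f\<close>. Thus \<open>w_deriv\<close> is the second-order equation, and
  \<open>w_eq\<close> recovers the slope from \<open>w\<close>.\<close>

locale wave_equation = decreasing_profile +
  fixes p :: real and h \<rho> d w :: "real \<Rightarrow> real"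
  assumes p: "p > 1"
    and h_cont: "continuous_on {0..1} h"
    and \<rho>_cont: "continuous_on {0<..<1} \<rho>"
    and d_cont: "continuous_on {0<..<1} d"
    and \<rho>_pos: "\<And>v. v \<in> {0<..<1} \<Longrightarrow> \<rho> v > 0"
    and d_pos: "\<And>v. v \<in> {0<..<1} \<Longrightarrow> d v > 0"
    and w_eq: "\<And>t. t \<in> einterval \<alpha> \<beta> \<Longrightarrow> w t = d (u t) * (- u' t) powr (p - 1)"
    and w_deriv: "\<And>t. t \<in> einterval \<alpha> \<beta> \<Longrightarrow>
      (w has_real_derivative h (u t) * u' t + \<rho> (u t)) (at t)"
    and w_lim: "(w \<longlongrightarrow> 0) (at_left_end \<alpha>)"
begin

text \<open>The critical size of \<open>w\<close>: when \<open>w t = \<phi> (u t)\<close>, the slope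
  \<open>- u' t\<close> equals the reaction \<open>\<rho> (u t)\<close>.\<close>

definition \<phi> :: "real \<Rightarrow> real" where "\<phi> v = d v * \<rho> v powr (p - 1)"

lemma q_pos: "1 / (p - 1) > 0" and q_inverse: "1 / (p - 1) * (p - 1) = 1" "(p - 1) * (1 / (p - 1)) = 1"
  using p by auto

lemma \<phi>_pos: "v \<in> {0<..<1} \<Longrightarrow> \<phi> v > 0"
  using d_pos[of v] \<rho>_pos[of v] by (simp add: \<phi>_def)

lemma \<phi>_powr: "v \<in> {0<..<1} \<Longrightarrow> \<phi> v powr (1 / (p - 1)) = \<rho> v * d v powr (1 / (p - 1))"
  using d_pos[of v] \<rho>_pos[of v] p by (simp add: \<phi>_def powr_mult powr_powr)

lemma w_pos: "t \<in> einterval \<alpha> \<beta> \<Longrightarrow> w t > 0"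
  using d_pos[OF u_range, of t] u'_neg[of t] by (simp add: w_eq)

lemma slope_eq:
  assumes "t \<in> einterval \<alpha> \<beta>"
  shows "- u' t = (w t / d (u t)) powr (1 / (p - 1))"
  using assms d_pos[OF u_range, of t] u'_neg[of t] p by (simp add: w_eq powr_powr)

lemma slope_div_reaction:
  assumes "t \<in> einterval \<alpha> \<beta>"
  shows "1 / \<rho> (u t) * - u' t = (w t / \<phi> (u t)) powr (1 / (p - 1))"
  using assms d_pos[OF u_range, of t] \<rho>_pos[OF u_range, of t] w_pos[of t] \<phi>_pos[OF u_range, of t]
  by (simp add: slope_eq powr_divide \<phi>_powr[OF u_range] del: greaterThanLessThan_iff)

lemma reaction_eq:
  assumes "t \<in> einterval \<alpha> \<beta>"
  shows "\<rho> (u t) = (\<phi> (u t) / w t) powr (1 / (p - 1)) * - u' t"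
  using assms d_pos[OF u_range, of t] \<rho>_pos[OF u_range, of t] w_pos[of t] \<phi>_pos[OF u_range, of t]
  by (simp add: slope_eq powr_divide \<phi>_powr[OF u_range] del: greaterThanLessThan_iff)

lemma barrier_limit:
  assumes "(B \<longlongrightarrow> 0) (at_left 1)"
  shows "((\<lambda>t. w t - B (u t)) \<longlongrightarrow> 0) (at_left_end \<alpha>)"
  using tendsto_diff[OF w_lim filterlim_compose[OF assms u_at_left]] by simp

text \<open>The reaction is a multiple of \<open>- u' t\<close>, so this positive factor can be
  pulled out and the bracket decides the sign. The bracket is strictly decreasing in
  \<open>w\<close>, which drives both comparison lemmas.\<close>

lemma barrier_deriv:
  assumes "t \<in> einterval \<alpha> \<beta>" "(B has_real_derivative B') (at (u t))"
  shows "((\<lambda>t. w t - B (u t)) has_real_derivative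
    - u' t * (B' + (\<phi> (u t) / w t) powr (1 / (p - 1)) - h (u t))) (at t)"
proof -
  have "((\<lambda>t. w t - B (u t)) has_real_derivative h (u t) * u' t + \<rho> (u t) - B' * u' t) (at t)"
    by (intro DERIV_diff w_deriv DERIV_chain2[where f = B and g = u] u_deriv assms)
  moreover have "h (u t) * u' t + \<rho> (u t) - B' * u' t =
    - u' t * (B' + (\<phi> (u t) / w t) powr (1 / (p - 1)) - h (u t))"
    by (subst reaction_eq[OF assms(1)]) (simp add: algebra_simps)
  ultimately show ?thesis by simp
qed

text \<open>Where \<open>w\<close> exceeds the barrier, monotonicity in \<open>w\<close> makes the
  bracket smaller than its value at \<open>B\<close>, which is at most 0. So the difference has a
  negative derivative wherever it is positive, and \<open>nonpos_at_left_end\<close> excludes that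
  near \<alpha>.\<close>

lemma upper_barrier:
  assumes lim: "(B \<longlongrightarrow> 0) (at_left 1)"
    and super: "eventually (\<lambda>v. B v > 0 \<and> (B has_real_derivative B' v) (at v) \<and>
      (\<phi> v / B v) powr (1 / (p - 1)) \<le> h v - B' v) (at_left 1)"
  shows "eventually (\<lambda>t. w t \<le> B (u t)) (at_left_end \<alpha>)"
proof -
  have "eventually (\<lambda>t. w t - B (u t) \<le> 0) (at_left_end \<alpha>)"
  proof (rule nonpos_at_left_end[OF ends barrier_limit[OF lim]])
    show "eventually (\<lambda>t. ((\<lambda>t. w t - B (u t)) has_real_derivative
        - u' t * (B' (u t) + (\<phi> (u t) / w t) powr (1 / (p - 1)) - h (u t))) (at t) \<and>
      (w t - B (u t) > 0 \<longrightarrow>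
        - u' t * (B' (u t) + (\<phi> (u t) / w t) powr (1 / (p - 1)) - h (u t)) < 0)) (at_left_end \<alpha>)"
      using eventually_in_domain eventually_left_1[OF super]
    proof (eventually_elim, intro conjI impI)
      case (elim t)
      show "((\<lambda>t. w t - B (u t)) has_real_derivative
          - u' t * (B' (u t) + (\<phi> (u t) / w t) powr (1 / (p - 1)) - h (u t))) (at t)"
        using elim by (intro barrier_deriv) auto
      assume "w t - B (u t) > 0"
      then have "\<phi> (u t) / w t < \<phi> (u t) / B (u t)"
        using elim \<phi>_pos[OF u_range[of t]] by (intro divide_strict_left_mono) auto
      then have "(\<phi> (u t) / w t) powr (1 / (p - 1)) < (\<phi> (u t) / B (u t)) powr (1 / (p - 1))"
        using elim \<phi>_pos[OF u_range[of t]] w_pos[of t] by (intro powr_less_mono2 q_pos) auto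
      then show "- u' t * (B' (u t) + (\<phi> (u t) / w t) powr (1 / (p - 1)) - h (u t)) < 0"
        using elim u'_neg[of t] by (intro mult_pos_neg) auto
    qed
  qed
  then show ?thesis by simp
qed

text \<open>The mirror image: where \<open>w\<close> is below the barrier the bracket is positive,
  so the negated difference decreases wherever it is positive.\<close>

lemma lower_barrier:
  assumes lim: "(B \<longlongrightarrow> 0) (at_left 1)"
    and sub: "eventually (\<lambda>v. B v > 0 \<and> (B has_real_derivative B' v) (at v) \<and>
      h v - B' v \<le> (\<phi> v / B v) powr (1 / (p - 1))) (at_left 1)"
  shows "eventually (\<lambda>t. B (u t) \<le> w t) (at_left_end \<alpha>)"
proof -
  have "eventually (\<lambda>t. - (w t - B (u t)) \<le> 0) (at_left_end \<alpha>)"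
  proof (rule nonpos_at_left_end[OF ends])
    show "((\<lambda>t. - (w t - B (u t))) \<longlongrightarrow> 0) (at_left_end \<alpha>)"
      using tendsto_minus[OF barrier_limit[OF lim]] by simp
    show "eventually (\<lambda>t. ((\<lambda>t. - (w t - B (u t))) has_real_derivative
        - (- u' t * (B' (u t) + (\<phi> (u t) / w t) powr (1 / (p - 1)) - h (u t)))) (at t) \<and>
      (- (w t - B (u t)) > 0 \<longrightarrow>
        - (- u' t * (B' (u t) + (\<phi> (u t) / w t) powr (1 / (p - 1)) - h (u t))) < 0)) (at_left_end \<alpha>)"
      using eventually_in_domain eventually_left_1[OF sub]
    proof (eventually_elim, intro conjI impI)
      case (elim t)
      show "((\<lambda>t. - (w t - B (u t))) has_real_derivative
          - (- u' t * (B' (u t) + (\<phi> (u t) / w t) powr (1 / (p - 1)) - h (u t)))) (at t)"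
        using elim by (intro DERIV_minus barrier_deriv) auto
      assume "- (w t - B (u t)) > 0"
      then have "\<phi> (u t) / B (u t) < \<phi> (u t) / w t"
        using elim \<phi>_pos[OF u_range[of t]] w_pos[of t] by (intro divide_strict_left_mono) auto
      then have "(\<phi> (u t) / B (u t)) powr (1 / (p - 1)) < (\<phi> (u t) / w t) powr (1 / (p - 1))"
        using elim \<phi>_pos[OF u_range[of t]] by (intro powr_less_mono2 q_pos) auto
      then have "- u' t * (B' (u t) + (\<phi> (u t) / w t) powr (1 / (p - 1)) - h (u t)) > 0"
        using elim u'_neg[of t] by (intro mult_pos_pos) auto
      then show "- (- u' t * (B' (u t) + (\<phi> (u t) / w t) powr (1 / (p - 1)) - h (u t))) < 0"
        by simp
    qed
  qed
  then show ?thesis by simp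
qed

section \<open>Barriers near v = 1\<close>

lemma eventually_unit_interval: "eventually (\<lambda>v::real. v \<in> {0<..<1}) (at_left 1)"
  by (rule eventually_at_leftI[of 0]) auto

lemma h_lim: "(h \<longlongrightarrow> h 1) (at_left 1)"
proof -
  have "(h \<longlongrightarrow> h 1) (at 1 within {0..1})"
    using h_cont unfolding continuous_on_def by simp
  then show ?thesis by (simp add: at_within_Icc_at_left)
qed

lemma powr_div_linear:
  assumes "v \<in> {0<..<1}" "K > 0"
  shows "(\<phi> v / (K * (1 - v))) powr (1 / (p - 1)) =
    \<rho> v * (d v / (1 - v)) powr (1 / (p - 1)) * K powr - (1 / (p - 1))"
proof -
  have "(\<phi> v / (K * (1 - v))) powr (1 / (p - 1)) =
    \<phi> v powr (1 / (p - 1)) / (K powr (1 / (p - 1)) * (1 - v) powr (1 / (p - 1)))"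
    using assms \<phi>_pos[of v] by (subst powr_divide powr_mult; simp)+
  also have "\<dots> = \<rho> v * (d v / (1 - v)) powr (1 / (p - 1)) * K powr - (1 / (p - 1))"
    using assms d_pos[of v] by (simp add: \<phi>_powr powr_divide powr_minus_divide)
  finally show ?thesis .
qed

text \<open>The barrier \<open>K * (1 - v)\<close> has slope \<open>- K\<close>, so
  \<open>h v - B' v\<close> grows with \<open>K\<close>, while the reaction term stays bounded
  because of the limit.\<close>

lemma linear_upper_bound:
  assumes "((\<lambda>v. \<rho> v * (d v / (1 - v)) powr (1 / (p - 1))) \<longlongrightarrow> l) (at_left 1)"
  shows "\<exists>K>0. eventually (\<lambda>t. w t \<le> K * (1 - u t)) (at_left_end \<alpha>)"
proof -
  \<comment> \<open>\<open>K \<ge> 1\<close> keeps the power of \<open>K\<close> at most 1;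
    \<open>K \<ge> l + 2 - h 1\<close> gives \<open>l + 1 \<le> h 1 - 1 + K\<close>, with one unit
    of slack for each of the two limits.\<close>
  define K where "K = max 1 (l + 2 - h 1)"
  have "K powr - (1 / (p - 1)) \<le> K powr 0"
    using q_pos by (intro powr_mono) (auto simp: K_def)
  moreover have K: "K \<ge> 1" "K \<ge> l + 2 - h 1" by (auto simp: K_def)
  ultimately have K_powr: "K powr - (1 / (p - 1)) \<le> 1" by simp
  have "eventually (\<lambda>t. w t \<le> K * (1 - u t)) (at_left_end \<alpha>)"
  proof (rule upper_barrier[where B' = "\<lambda>_. - K"])
    show "((\<lambda>v. K * (1 - v)) \<longlongrightarrow> 0) (at_left 1)"
      by (auto intro!: tendsto_eq_intros)
    have "eventually (\<lambda>v. \<rho> v * (d v / (1 - v)) powr (1 / (p - 1)) < l + 1) (at_left 1)"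
      by (rule order_tendstoD[OF assms]) simp
    moreover have "eventually (\<lambda>v. h v > h 1 - 1) (at_left 1)"
      by (rule order_tendstoD[OF h_lim]) simp
    ultimately show "eventually (\<lambda>v. 0 < K * (1 - v) \<and>
      ((\<lambda>v. K * (1 - v)) has_real_derivative - K) (at v) \<and>
      (\<phi> v / (K * (1 - v))) powr (1 / (p - 1)) \<le> h v - - K) (at_left 1)"
      using eventually_unit_interval
    proof eventually_elim
      case (elim v)
      have "(\<phi> v / (K * (1 - v))) powr (1 / (p - 1)) \<le> \<rho> v * (d v / (1 - v)) powr (1 / (p - 1)) * 1"
        using elim K K_powr \<rho>_pos[of v] by (subst powr_div_linear) (auto intro!: mult_left_le)
      with elim K show ?case by (auto intro!: derivative_eq_intros)
    qed
  qed
  with K show ?thesis by (intro exI[of _ K]) auto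
qed

text \<open>With \<open>k = - h 1 / 2\<close> the quantity \<open>h v + k\<close> is negative near
  1, whereas a power is nonnegative, so the inequality for a lower barrier holds at once.\<close>

lemma linear_lower_bound:
  assumes "h 1 < 0"
  shows "\<exists>k>0. eventually (\<lambda>t. k * (1 - u t) \<le> w t) (at_left_end \<alpha>)"
proof -
  define k where "k = - h 1 / 2"
  have k: "k > 0" using assms by (simp add: k_def)
  have "eventually (\<lambda>t. k * (1 - u t) \<le> w t) (at_left_end \<alpha>)"
  proof (rule lower_barrier[where B' = "\<lambda>_. - k"])
    show "((\<lambda>v. k * (1 - v)) \<longlongrightarrow> 0) (at_left 1)"
      by (auto intro!: tendsto_eq_intros)
    have "eventually (\<lambda>v. h v < - k) (at_left 1)"
      by (rule order_tendstoD[OF h_lim]) (use assms in \<open>simp add: k_def\<close>)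
    then show "eventually (\<lambda>v. 0 < k * (1 - v) \<and>
      ((\<lambda>v. k * (1 - v)) has_real_derivative - k) (at v) \<and>
      h v - - k \<le> (\<phi> v / (k * (1 - v))) powr (1 / (p - 1))) (at_left 1)"
      using eventually_unit_interval
    proof eventually_elim
      case (elim v)
      then have "h v - - k \<le> 0" by simp
      also have "\<dots> \<le> (\<phi> v / (k * (1 - v))) powr (1 / (p - 1))" by simp
      finally show ?case using elim k by (auto intro!: derivative_eq_intros)
    qed
  qed
  with k show ?thesis by blast
qed

text \<open>For the barrier \<open>k * \<xi> v\<close> the reaction term is at least
  \<open>(\<mu> / k) powr (1 / (p - 1))\<close>, which is arbitrarily large for small
  \<open>k\<close>, while \<open>h v - k * \<xi>' v\<close> stays bounded for
  \<open>k \<le> 1\<close>.\<close>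

lemma comparable_lower_bound:
  assumes \<mu>: "\<mu> > 0" and \<xi>: "(\<xi> \<longlongrightarrow> 0) (at_left 1)" and \<xi>': "(\<xi>' \<longlongrightarrow> L) (at_left 1)"
    and comp: "eventually (\<lambda>v. \<xi> v > 0 \<and> (\<xi> has_real_derivative \<xi>' v) (at v) \<and> \<mu> * \<xi> v \<le> \<phi> v) (at_left 1)"
  shows "\<exists>k>0. eventually (\<lambda>t. k * \<xi> (u t) \<le> w t) (at_left_end \<alpha>)"
proof -
  \<comment> \<open>The 2 absorbs one unit of deviation of \<open>h v\<close> from
    \<open>h 1\<close> and one of \<open>\<bar>\<xi>' v\<bar>\<close> from
    \<open>\<bar>L\<bar>\<close>.\<close>
  define A where "A = (\<bar>h 1\<bar> + \<bar>L\<bar> + 2) / \<mu> powr (1 / (p - 1))"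
  obtain k where k: "0 < k" "k \<le> 1" "A \<le> k powr - (1 / (p - 1))"
    by (rule powr_neg_unbounded[OF q_pos])
  have "\<bar>h 1\<bar> + \<bar>L\<bar> + 2 = A * \<mu> powr (1 / (p - 1))" using \<mu> by (simp add: A_def)
  also have "\<dots> \<le> k powr - (1 / (p - 1)) * \<mu> powr (1 / (p - 1))"
    using k(3) by (intro mult_right_mono) auto
  also have "\<dots> = (\<mu> / k) powr (1 / (p - 1))"
    using k \<mu> by (simp add: powr_divide powr_minus field_simps)
  finally have A: "\<bar>h 1\<bar> + \<bar>L\<bar> + 2 \<le> (\<mu> / k) powr (1 / (p - 1))" .
  have "eventually (\<lambda>t. k * \<xi> (u t) \<le> w t) (at_left_end \<alpha>)"
  proof (rule lower_barrier[where B' = "\<lambda>v. k * \<xi>' v"])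
    show "((\<lambda>v. k * \<xi> v) \<longlongrightarrow> 0) (at_left 1)"
      using tendsto_mult_right_zero[OF \<xi>] .
    have "eventually (\<lambda>v. h v < h 1 + 1) (at_left 1)"
      by (rule order_tendstoD[OF h_lim]) simp
    moreover have "eventually (\<lambda>v. \<bar>\<xi>' v\<bar> < \<bar>L\<bar> + 1) (at_left 1)"
      by (rule order_tendstoD[OF tendsto_rabs[OF \<xi>']]) simp
    ultimately show "eventually (\<lambda>v. 0 < k * \<xi> v \<and>
      ((\<lambda>v. k * \<xi> v) has_real_derivative k * \<xi>' v) (at v) \<and>
      h v - k * \<xi>' v \<le> (\<phi> v / (k * \<xi> v)) powr (1 / (p - 1))) (at_left 1)"
      using comp
    proof eventually_elim
      case (elim v)
      have "\<bar>k * \<xi>' v\<bar> \<le> 1 * \<bar>\<xi>' v\<bar>" using k unfolding abs_mult by (intro mult_right_mono) auto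
      then have "h v - k * \<xi>' v \<le> \<bar>h 1\<bar> + \<bar>L\<bar> + 2" using elim by linarith
      also note A
      also have "\<mu> / k \<le> \<phi> v / (k * \<xi> v)"
        using elim k by (simp add: field_simps)
      then have "(\<mu> / k) powr (1 / (p - 1)) \<le> (\<phi> v / (k * \<xi> v)) powr (1 / (p - 1))"
        using k \<mu> q_pos by (intro powr_mono2) auto
      finally show ?case using elim k by (auto intro!: DERIV_cmult)
    qed
  qed
  with k show ?thesis by blast
qed

text \<open>Since \<open>h 1 > 0\<close> and \<open>\<xi>'\<close> tends to 0,
  \<open>h v - K * \<xi>' v\<close> exceeds \<open>h 1 / 4\<close> near 1 for any fixed
  \<open>K\<close>. A large \<open>K\<close> brings the reaction term down to that level.\<close>

lemma comparable_upper_bound: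
  assumes M: "M > 0" and h1: "h 1 > 0"
    and \<xi>: "(\<xi> \<longlongrightarrow> 0) (at_left 1)" and \<xi>': "(\<xi>' \<longlongrightarrow> 0) (at_left 1)"
    and comp: "eventually (\<lambda>v. \<xi> v > 0 \<and> (\<xi> has_real_derivative \<xi>' v) (at v) \<and> \<phi> v \<le> M * \<xi> v) (at_left 1)"
  shows "\<exists>K>0. eventually (\<lambda>t. w t \<le> K * \<xi> (u t)) (at_left_end \<alpha>)"
proof -
  \<comment> \<open>This \<open>K\<close> solves
    \<open>(M / K) powr (1 / (p - 1)) = h 1 / 4\<close>; the margins used below are
    \<open>h v > h 1 / 2\<close> and \<open>K * \<xi>' v < h 1 / 4\<close>.\<close>
  define K where "K = M / (h 1 / 4) powr (p - 1)"
  have K: "K > 0" using M h1 by (simp add: K_def)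
  have MK: "(M / K) powr (1 / (p - 1)) = h 1 / 4"
  proof -
    have "M / K = (h 1 / 4) powr (p - 1)" using M h1 by (simp add: K_def)
    then show ?thesis using h1 by (simp only: powr_powr q_inverse) simp
  qed
  have "eventually (\<lambda>t. w t \<le> K * \<xi> (u t)) (at_left_end \<alpha>)"
  proof (rule upper_barrier[where B' = "\<lambda>v. K * \<xi>' v"])
    show "((\<lambda>v. K * \<xi> v) \<longlongrightarrow> 0) (at_left 1)"
      using tendsto_mult_right_zero[OF \<xi>] .
    have "eventually (\<lambda>v. h v > h 1 / 2) (at_left 1)"
      by (rule order_tendstoD[OF h_lim]) (use h1 in simp)
    moreover have "eventually (\<lambda>v. K * \<xi>' v < h 1 / 4) (at_left 1)"
      by (rule order_tendstoD[OF tendsto_mult_right_zero[OF \<xi>']]) (use h1 in simp)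
    ultimately show "eventually (\<lambda>v. 0 < K * \<xi> v \<and>
      ((\<lambda>v. K * \<xi> v) has_real_derivative K * \<xi>' v) (at v) \<and>
      (\<phi> v / (K * \<xi> v)) powr (1 / (p - 1)) \<le> h v - K * \<xi>' v) (at_left 1)"
      using comp eventually_unit_interval
    proof eventually_elim
      case (elim v)
      have "\<phi> v / (K * \<xi> v) \<le> M / K"
        using elim K by (simp add: field_simps)
      then have "(\<phi> v / (K * \<xi> v)) powr (1 / (p - 1)) \<le> (M / K) powr (1 / (p - 1))"
        using K elim q_pos \<phi>_pos[of v] by (intro powr_mono2) auto
      with elim K MK show ?case by (auto intro!: DERIV_cmult)
    qed
  qed
  with K show ?thesis by blast
qed

section \<open>From bounds on w to the integral of the reciprocal reaction\<close>

lemma reaction_reciprocal_cont: "continuous_on {0<..<1} (\<lambda>v. 1 / \<rho> v)"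
  using \<rho>_pos by (intro continuous_intros \<rho>_cont) force

text \<open>From \<open>k * \<xi> \<le> w\<close> and \<open>\<phi> \<le> M * \<xi>\<close> follows
  \<open>w / \<phi> \<ge> k / M\<close>, so \<open>1 / \<rho>\<close> times the slope stays away
  from 0 and \<open>left_end_finite\<close> applies.\<close>

lemma left_end_finite_of_reaction:
  assumes "k > 0" "M > 0"
    and lower: "eventually (\<lambda>t. k * \<xi> (u t) \<le> w t) (at_left_end \<alpha>)"
    and comp: "eventually (\<lambda>v. \<xi> v > 0 \<and> \<phi> v \<le> M * \<xi> v) (at_left 1)"
    and fin: "(\<integral>\<^sup>+v\<in>{1/2<..<1}. ennreal (1 / \<rho> v) \<partial>lborel) < \<infinity>"
  shows "\<alpha> > -\<infinity>"
proof (rule left_end_finite[OF reaction_reciprocal_cont _ _ fin])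
  show "(k / M) powr (1 / (p - 1)) > 0" using assms by simp
  show "eventually (\<lambda>t. (k / M) powr (1 / (p - 1)) \<le> 1 / \<rho> (u t) * - u' t) (at_left_end \<alpha>)"
    using lower eventually_left_1[OF comp] eventually_in_domain
  proof eventually_elim
    case (elim t)
    have \<phi>: "\<phi> (u t) > 0" using elim by (intro \<phi>_pos u_range)
    have "k * \<phi> (u t) \<le> k * (M * \<xi> (u t))" using elim \<open>k > 0\<close> by (intro mult_left_mono) auto
    also have "\<dots> \<le> M * w t" using elim \<open>M > 0\<close> by (simp add: mult.left_commute)
    finally have "k / M \<le> w t / \<phi> (u t)" using \<phi> \<open>M > 0\<close> by (simp add: field_simps)
    then show ?case
      unfolding slope_div_reaction[OF elim(3)] using q_pos \<open>k > 0\<close> \<open>M > 0\<close> by (intro powr_mono2) auto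
  qed
qed

text \<open>Dually \<open>w / \<phi> \<le> K / \<mu>\<close>, so \<open>1 / \<rho>\<close> times the
  slope stays bounded.\<close>

lemma nn_integral_reaction_finite:
  assumes "\<mu> > 0"
    and upper: "eventually (\<lambda>t. w t \<le> K * \<xi> (u t)) (at_left_end \<alpha>)"
    and "K > 0"
    and comp: "eventually (\<lambda>v. \<xi> v > 0 \<and> \<mu> * \<xi> v \<le> \<phi> v) (at_left 1)"
    and "\<alpha> > -\<infinity>"
  shows "(\<integral>\<^sup>+v\<in>{1/2<..<1}. ennreal (1 / \<rho> v) \<partial>lborel) < \<infinity>"
proof (rule nn_integral_finite[OF reaction_reciprocal_cont _ \<open>\<alpha> > -\<infinity>\<close>])
  show "eventually (\<lambda>t. 1 / \<rho> (u t) * - u' t \<le> (K / \<mu>) powr (1 / (p - 1))) (at_left_end \<alpha>)"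
    using upper eventually_left_1[OF comp] eventually_in_domain
  proof eventually_elim
    case (elim t)
    have \<phi>: "\<phi> (u t) > 0" using elim by (intro \<phi>_pos u_range)
    have "\<mu> * w t \<le> \<mu> * (K * \<xi> (u t))" using elim \<open>\<mu> > 0\<close> by (intro mult_left_mono) auto
    also have "\<dots> \<le> K * \<phi> (u t)" using elim \<open>K > 0\<close> by (simp add: mult.left_commute)
    finally have "w t / \<phi> (u t) \<le> K / \<mu>" using \<phi> \<open>\<mu> > 0\<close> by (simp add: field_simps)
    then show ?case
      unfolding slope_div_reaction[OF elim(3)] using q_pos w_pos[OF elim(3)] \<phi> by (intro powr_mono2) auto
  qed
qed

section \<open>The cases, by the limit at 1 and the sign of h(1)\<close>

text \<open>The function raised to the power \<open>p - 1\<close> is the one whose limit at 1 is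
  prescribed, so that limit decides how \<open>\<phi> v\<close> compares with
  \<open>1 - v\<close>.\<close>

lemma \<phi>_eq_linear:
  assumes "v \<in> {0<..<1}"
  shows "\<phi> v = (1 - v) * (\<rho> v * (d v / (1 - v)) powr (1 / (p - 1))) powr (p - 1)"
  using assms d_pos[of v] \<rho>_pos[of v] p by (simp add: \<phi>_def powr_mult powr_powr)

text \<open>A positive limit makes \<open>\<phi> v\<close> comparable to \<open>1 - v\<close>, so
  \<open>1 - v\<close> itself serves as \<open>\<xi>\<close>, and \<open>w\<close> is squeezed
  between two multiples of it.\<close>

lemma positive_limit_case:
  assumes lim: "((\<lambda>v. \<rho> v * (d v / (1 - v)) powr (1 / (p - 1))) \<longlongrightarrow> l) (at_left 1)" and "l > 0"
  shows "\<alpha> > -\<infinity> \<longleftrightarrow> (\<integral>\<^sup>+v\<in>{1/2<..<1}. ennreal (1 / \<rho> v) \<partial>lborel) < \<infinity>"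
proof -
  define \<mu> M where "\<mu> = (l / 2) powr (p - 1)" and "M = (2 * l) powr (p - 1)"
  have pos: "\<mu> > 0" "M > 0" using \<open>l > 0\<close> by (auto simp: \<mu>_def M_def)
  have "eventually (\<lambda>v. \<rho> v * (d v / (1 - v)) powr (1 / (p - 1)) > l / 2) (at_left 1)"
    "eventually (\<lambda>v. \<rho> v * (d v / (1 - v)) powr (1 / (p - 1)) < 2 * l) (at_left 1)"
    using order_tendstoD(1)[OF lim, of "l / 2"] order_tendstoD(2)[OF lim, of "2 * l"] \<open>l > 0\<close> by simp_all
  with eventually_unit_interval have comp:
    "eventually (\<lambda>v. 1 - v > 0 \<and> ((\<lambda>v. 1 - v) has_real_derivative -1) (at v) \<and>
      \<mu> * (1 - v) \<le> \<phi> v \<and> \<phi> v \<le> M * (1 - v)) (at_left 1)"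
  proof eventually_elim
    case (elim v)
    let ?m = "\<rho> v * (d v / (1 - v)) powr (1 / (p - 1))"
    have "\<mu> \<le> ?m powr (p - 1)" "?m powr (p - 1) \<le> M"
      using elim \<open>l > 0\<close> p unfolding \<mu>_def M_def by (auto intro!: powr_mono2)
    with elim show ?case
      by (subst (1 2) \<phi>_eq_linear) (auto simp: mult.commute[of "1 - v"] intro!: mult_right_mono derivative_eq_intros)
  qed
  obtain k where k: "k > 0" "eventually (\<lambda>t. k * (1 - u t) \<le> w t) (at_left_end \<alpha>)"
  proof -
    have "((\<lambda>v::real. 1 - v) \<longlongrightarrow> 0) (at_left 1)" by (auto intro!: tendsto_eq_intros)
    then show thesis
      using comparable_lower_bound[OF pos(1) _ tendsto_const, of "\<lambda>v. 1 - v" "-1"] comp that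
      by (auto simp: eventually_conj_iff)
  qed
  obtain K where K: "K > 0" "eventually (\<lambda>t. w t \<le> K * (1 - u t)) (at_left_end \<alpha>)"
    using linear_upper_bound[OF lim] by auto
  show ?thesis
    using left_end_finite_of_reaction[OF k(1) pos(2) k(2)] nn_integral_reaction_finite[OF pos(1) K(2) K(1)]
      comp by (auto simp: eventually_conj_iff)
qed

text \<open>Both linear barriers are available, so \<open>w\<close> is comparable to
  \<open>1 - u\<close>. In the integrand times the slope the factor \<open>d\<close> cancels; what
  remains is a power of \<open>w / (1 - u)\<close>, bounded and bounded away from 0.\<close>

lemma negative_drift_case:
  assumes lim: "((\<lambda>v. \<rho> v * (d v / (1 - v)) powr (1 / (p - 1))) \<longlongrightarrow> l) (at_left 1)" and "h 1 < 0"
  shows "\<alpha> > -\<infinity> \<longleftrightarrow> (\<integral>\<^sup>+v\<in>{1/2<..<1}. ennreal ((d v / (1 - v)) powr (1 / (p - 1))) \<partial>lborel) < \<infinity>"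
proof -
  obtain k where k: "k > 0" "eventually (\<lambda>t. k * (1 - u t) \<le> w t) (at_left_end \<alpha>)"
    using linear_lower_bound[OF \<open>h 1 < 0\<close>] by auto
  obtain K where K: "K > 0" "eventually (\<lambda>t. w t \<le> K * (1 - u t)) (at_left_end \<alpha>)"
    using linear_upper_bound[OF lim] by auto
  have cont: "continuous_on {0<..<1} (\<lambda>v. (d v / (1 - v)) powr (1 / (p - 1)))"
    using d_pos by (intro continuous_intros continuous_on_powr' d_cont) force+
  have eq: "(d (u t) / (1 - u t)) powr (1 / (p - 1)) * - u' t = (w t / (1 - u t)) powr (1 / (p - 1))"
    if "t \<in> einterval \<alpha> \<beta>" for t
    using that d_pos[OF u_range, of t] u_range[of t] w_pos[of t]
    by (simp add: slope_eq powr_divide)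
  have "eventually (\<lambda>t. k powr (1 / (p - 1)) \<le> (d (u t) / (1 - u t)) powr (1 / (p - 1)) * - u' t) (at_left_end \<alpha>)"
    using eventually_in_domain k(2)
  proof eventually_elim
    case (elim t)
    then show ?case
      unfolding eq[OF elim(1)] using q_pos k(1) u_range[of t] by (intro powr_mono2) (auto simp: field_simps)
  qed
  moreover have "eventually (\<lambda>t. (d (u t) / (1 - u t)) powr (1 / (p - 1)) * - u' t \<le> K powr (1 / (p - 1))) (at_left_end \<alpha>)"
    using eventually_in_domain K(2)
  proof eventually_elim
    case (elim t)
    then show ?case
      unfolding eq[OF elim(1)] using q_pos w_pos[of t] u_range[of t] by (intro powr_mono2) (auto simp: field_simps)
  qed
  moreover have "k powr (1 / (p - 1)) > 0" using k(1) by simp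
  ultimately show ?thesis
    using left_end_finite[OF cont] nn_integral_finite[OF cont] by (intro iffI)
qed

text \<open>As the limit is 0, \<open>\<phi> v\<close>, and with it \<open>\<xi> v\<close>, is of
  smaller order than \<open>1 - v\<close>. Therefore \<open>\<xi>\<close> and its derivative both
  vanish at 1, as the barriers require.\<close>

lemma C1_comparable:
  assumes lim: "((\<lambda>v. \<rho> v * (d v / (1 - v)) powr (1 / (p - 1))) \<longlongrightarrow> 0) (at_left 1)"
    and comparable: "C1_comparable_near_1 p \<rho> d"
  obtains \<mu> M \<xi> \<xi>' where "\<mu> > 0" "M > 0" "(\<xi> \<longlongrightarrow> 0) (at_left 1)" "(\<xi>' \<longlongrightarrow> 0) (at_left 1)"
    "eventually (\<lambda>v. \<xi> v > 0 \<and> (\<xi> has_real_derivative \<xi>' v) (at v) \<and> \<mu> * \<xi> v \<le> \<phi> v \<and> \<phi> v \<le> M * \<xi> v) (at_left 1)"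
proof -
  obtain \<delta> \<mu> M \<xi> \<xi>' where \<delta>: "0 < \<delta>" "\<delta> < 1" and \<mu>: "\<mu> > 0" and M: "M > 0"
    and \<xi>'_cont: "continuous_on {1-\<delta>..1} \<xi>'"
    and \<xi>_deriv: "\<And>x. x \<in> {1-\<delta>..1} \<Longrightarrow> (\<xi> has_real_derivative \<xi>' x) (at x within {1-\<delta>..1})"
    and comp: "\<And>v. v \<in> {1-\<delta>..<1} \<Longrightarrow> \<mu> * \<xi> v \<le> \<phi> v" "\<And>v. v \<in> {1-\<delta>..<1} \<Longrightarrow> \<phi> v \<le> M * \<xi> v"
    using comparable unfolding C1_comparable_near_1_def C1_on_closed_interval_def \<phi>_def by blast
  have within: "at 1 within {1-\<delta>..1} = at_left 1" using \<delta> by (simp add: at_within_Icc_at_left)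
  \<comment> \<open>On the open interval the derivative within \<open>{1-\<delta>..1}\<close> is a
    two-sided derivative.\<close>
  have near: "eventually (\<lambda>v. v \<in> {1-\<delta><..<1}) (at_left 1)"
    using \<delta> by (intro eventually_at_leftI[of "1-\<delta>"]) auto
  have \<xi>_pos: "\<xi> v > 0" if "v \<in> {1-\<delta><..<1}" for v
    using comp(2)[of v] \<phi>_pos[of v] that \<delta> M by (auto simp: zero_less_mult_iff dest: less_le_trans)
  \<comment> \<open>Near 1 this is \<open>\<phi> v / (\<mu> * (1 - v))\<close>, an upper bound for
    \<open>\<xi> v / (1 - v)\<close>.\<close>
  have m: "((\<lambda>v. (\<rho> v * (d v / (1 - v)) powr (1 / (p - 1))) powr (p - 1) / \<mu>) \<longlongrightarrow> 0) (at_left 1)"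
  proof -
    have "eventually (\<lambda>v. 0 \<le> \<rho> v * (d v / (1 - v)) powr (1 / (p - 1))) (at_left 1)"
      using eventually_unit_interval by eventually_elim (use \<rho>_pos in \<open>simp add: less_imp_le\<close>)
    from tendsto_divide[OF tendsto_zero_powrI[OF lim tendsto_const this, of "p - 1"] tendsto_const[of \<mu>]]
    show ?thesis using p \<mu> by simp
  qed
  have quot: "((\<lambda>v. \<xi> v / (1 - v)) \<longlongrightarrow> 0) (at_left 1)"
  proof (rule tendsto_sandwich[OF _ _ tendsto_const m])
    show "eventually (\<lambda>v. 0 \<le> \<xi> v / (1 - v)) (at_left 1)"
      using near by eventually_elim (use \<xi>_pos in \<open>auto intro: less_imp_le\<close>)
    show "eventually (\<lambda>v. \<xi> v / (1 - v) \<le>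
      (\<rho> v * (d v / (1 - v)) powr (1 / (p - 1))) powr (p - 1) / \<mu>) (at_left 1)"
      using near
    proof eventually_elim
      case (elim v)
      then show ?case
        using comp(1)[of v] \<phi>_eq_linear[of v] \<delta> \<mu> by (simp add: field_simps)
    qed
  qed
  have "((\<lambda>v. \<xi> v / (1 - v) * (1 - v)) \<longlongrightarrow> 0 * (1 - 1)) (at_left 1)"
    by (intro tendsto_mult quot tendsto_intros)
  then have "((\<lambda>v. \<xi> v / (1 - v) * (1 - v)) \<longlongrightarrow> 0) (at_left 1)" by simp
  then have \<xi>_lim: "(\<xi> \<longlongrightarrow> 0) (at_left 1)"
    by (rule Lim_transform_eventually) (use near in \<open>eventually_elim, simp\<close>)
  have "(\<xi> \<longlongrightarrow> \<xi> 1) (at_left 1)"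
    using DERIV_continuous[OF \<xi>_deriv[of 1]] \<delta> unfolding within continuous_within by simp
  with \<xi>_lim have \<xi>1: "\<xi> 1 = 0" using tendsto_unique trivial_limit_at_left_real by blast
  \<comment> \<open>With \<open>\<xi> 1 = 0\<close> the difference quotient at 1 is
    \<open>- (\<xi> v / (1 - v))\<close>, so \<open>\<xi>' 1\<close> is found by computing its limit
    in two ways.\<close>
  have "((\<lambda>v. (\<xi> v - \<xi> 1) / (v - 1)) \<longlongrightarrow> \<xi>' 1) (at_left 1)"
    using \<xi>_deriv[of 1] \<delta> unfolding within has_field_derivative_iff by simp
  moreover have "((\<lambda>v. (\<xi> v - \<xi> 1) / (v - 1)) \<longlongrightarrow> 0) (at_left 1)"
    using tendsto_minus[OF quot] by (simp add: \<xi>1 minus_divide_right)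
  ultimately have "\<xi>' 1 = 0" using tendsto_unique trivial_limit_at_left_real by blast
  moreover have "(\<xi>' \<longlongrightarrow> \<xi>' 1) (at_left 1)"
    using \<xi>'_cont \<delta> unfolding continuous_on_def within[symmetric] by auto
  ultimately have \<xi>'_lim: "(\<xi>' \<longlongrightarrow> 0) (at_left 1)" by simp
  have "eventually (\<lambda>v. \<xi> v > 0 \<and> (\<xi> has_real_derivative \<xi>' v) (at v) \<and> \<mu> * \<xi> v \<le> \<phi> v \<and> \<phi> v \<le> M * \<xi> v) (at_left 1)"
    using near
  proof eventually_elim
    case (elim v)
    then have "at v within {1-\<delta>..1} = at v" by (simp add: at_within_Icc_at)
    with \<xi>_deriv[of v] elim show ?case using \<xi>_pos[of v] comp[of v] by auto
  qed
  from that[OF \<mu> M \<xi>_lim \<xi>'_lim this] show thesis .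
qed

text \<open>The lower barrier \<open>k * \<xi> v\<close> exists for every sign of
  \<open>h 1\<close>, so this direction serves positive and zero drift alike.\<close>

lemma comparable_case_left_end_finite:
  assumes lim: "((\<lambda>v. \<rho> v * (d v / (1 - v)) powr (1 / (p - 1))) \<longlongrightarrow> 0) (at_left 1)"
    and comparable: "C1_comparable_near_1 p \<rho> d"
    and fin: "(\<integral>\<^sup>+v\<in>{1/2<..<1}. ennreal (1 / \<rho> v) \<partial>lborel) < \<infinity>"
  shows "\<alpha> > -\<infinity>"
proof -
  obtain \<mu> M \<xi> \<xi>' where \<xi>: "\<mu> > 0" "M > 0" "(\<xi> \<longlongrightarrow> 0) (at_left 1)" "(\<xi>' \<longlongrightarrow> 0) (at_left 1)"
    "eventually (\<lambda>v. \<xi> v > 0 \<and> (\<xi> has_real_derivative \<xi>' v) (at v) \<and> \<mu> * \<xi> v \<le> \<phi> v \<and> \<phi> v \<le> M * \<xi> v) (at_left 1)"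
    using C1_comparable[OF lim comparable] .
  then obtain k where k: "k > 0" "eventually (\<lambda>t. k * \<xi> (u t) \<le> w t) (at_left_end \<alpha>)"
    using comparable_lower_bound[OF \<xi>(1,3,4)] by (auto simp: eventually_conj_iff)
  show ?thesis
    using left_end_finite_of_reaction[OF k(1) \<xi>(2) k(2) _ fin] \<xi>(5) by (simp add: eventually_conj_iff)
qed

text \<open>The upper barrier relies on positive drift; this separates the equivalence for
  \<open>h 1 > 0\<close> from the single implication for \<open>h 1 = 0\<close>.\<close>

lemma positive_drift_nn_integral_finite:
  assumes lim: "((\<lambda>v. \<rho> v * (d v / (1 - v)) powr (1 / (p - 1))) \<longlongrightarrow> 0) (at_left 1)"
    and comparable: "C1_comparable_near_1 p \<rho> d" and "h 1 > 0" and "\<alpha> > -\<infinity>"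
  shows "(\<integral>\<^sup>+v\<in>{1/2<..<1}. ennreal (1 / \<rho> v) \<partial>lborel) < \<infinity>"
proof -
  obtain \<mu> M \<xi> \<xi>' where \<xi>: "\<mu> > 0" "M > 0" "(\<xi> \<longlongrightarrow> 0) (at_left 1)" "(\<xi>' \<longlongrightarrow> 0) (at_left 1)"
    "eventually (\<lambda>v. \<xi> v > 0 \<and> (\<xi> has_real_derivative \<xi>' v) (at v) \<and> \<mu> * \<xi> v \<le> \<phi> v \<and> \<phi> v \<le> M * \<xi> v) (at_left 1)"
    using C1_comparable[OF lim comparable] .
  then obtain K where K: "K > 0" "eventually (\<lambda>t. w t \<le> K * \<xi> (u t)) (at_left_end \<alpha>)"
    using comparable_upper_bound[OF \<xi>(2) \<open>h 1 > 0\<close> \<xi>(3,4)] by (auto simp: eventually_conj_iff)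
  show ?thesis
    using nn_integral_reaction_finite[OF \<xi>(1) K(2,1) _ \<open>\<alpha> > -\<infinity>\<close>] \<xi>(5) by (simp add: eventually_conj_iff)
qed

end

section \<open>From travelling waves to the first-order equation\<close>

text \<open>At a zero of \<open>deriv u\<close> the equation says that the flux has derivative
  \<open>- \<rho> (u t) < 0\<close>. If \<open>deriv u t\<close> were nonnegative,
  \<open>pos_before_nonneg\<close> would make the slope positive at all earlier times, so
  \<open>u\<close> would be at most \<open>u t < 1\<close> there, against its limit 1 at
  \<alpha>.\<close>

lemma travelling_wave_decreasing:
  assumes sa: "standing_assumptions p f g \<rho> d" and tw: "travelling_wave p f g \<rho> d c \<alpha> \<beta> u"
    and t: "t \<in> einterval \<alpha> \<beta>"
  shows "deriv u t < 0"
proof (rule ccontr)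
  note tw' = tw[unfolded travelling_wave_def]
  note u = C1_differentiable_on_deriv[of u "einterval \<alpha> \<beta>"]
  note F = C1_differentiable_on_deriv[of "flux p d u" "einterval \<alpha> \<beta>"]
  have range: "0 < u s" "u s < 1" "d (u s) > 0" "\<rho> (u s) > 0" if "s \<in> einterval \<alpha> \<beta>" for s
    using that tw' sa by (auto simp: standing_assumptions_def)
  have flux_sgn: "flux p d u s > 0 \<longleftrightarrow> deriv u s > 0" "flux p d u s \<ge> 0 \<longleftrightarrow> deriv u s \<ge> 0"
    "flux p d u s = 0 \<longleftrightarrow> deriv u s = 0" if "s \<in> einterval \<alpha> \<beta>" for s
  proof -
    \<comment> \<open>The prefactor is positive except at a zero of \<open>deriv u\<close>, where
      \<open>0 powr (p - 2)\<close> is 0 by convention; hence the case distinction.\<close>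
    have "deriv u s = 0 \<or> d (u s) * \<bar>deriv u s\<bar> powr (p - 2) > 0"
      using range(3)[OF that] by (cases "deriv u s = 0") auto
    then show "flux p d u s > 0 \<longleftrightarrow> deriv u s > 0" "flux p d u s \<ge> 0 \<longleftrightarrow> deriv u s \<ge> 0"
      "flux p d u s = 0 \<longleftrightarrow> deriv u s = 0"
      unfolding flux_def by (metis mult_zero_right zero_less_mult_pos mult_pos_pos,
        metis mult_zero_right zero_le_mult_iff not_less less_imp_le, metis mult_eq_0_iff less_irrefl)
  qed
  assume "\<not> deriv u t < 0"
  then have Ft: "flux p d u t \<ge> 0" using flux_sgn t by simp
  have sub: "x \<in> einterval \<alpha> \<beta>" if "\<alpha> < ereal s" "x \<in> {s..t}" for s x
  proof -
    have "ereal s \<le> ereal x" "ereal x \<le> ereal t" using that by auto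
    then show ?thesis
      using that(1) t unfolding einterval_iff by (blast intro: less_le_trans le_less_trans)
  qed
  have pos: "deriv u s > 0" if s: "\<alpha> < ereal s" "s < t" for s
  proof -
    have "flux p d u s > 0"
    proof (rule pos_before_nonneg[where t = t and F = "flux p d u" and F' = "deriv (flux p d u)"])
      show "(flux p d u has_real_derivative deriv (flux p d u) x) (at x)" if "x \<in> {s..t}" for x
        using F(1)[OF _ sub[OF s(1) that]] tw' by simp
      show "deriv (flux p d u) x < 0" if "x \<in> {s..t}" "flux p d u x = 0" for x
      proof -
        have x: "x \<in> einterval \<alpha> \<beta>" using sub[OF s(1) that(1)] .
        then have "deriv (flux p d u) x + (c * g (u x) - f (u x)) * deriv u x + \<rho> (u x) = 0"
          using tw' by blast
        with flux_sgn(3)[OF x] that range(4)[OF x] show ?thesis by simp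
      qed
    qed (rule s(2) Ft)+
    then show ?thesis using flux_sgn(1)[of s] sub[of s s] s by simp
  qed
  have "u s \<le> u t" if s: "\<alpha> < ereal s" "s < t" for s
  proof (rule DERIV_nonneg_imp_nondecreasing[of s t])
    fix x assume x: "s \<le> x" "x \<le> t"
    then have "x \<in> einterval \<alpha> \<beta>" using sub s by simp
    then have "(u has_real_derivative deriv u x) (at x)" using u(1) tw' by blast
    moreover have "deriv u x \<ge> 0"
    proof (cases "x = t")
      case True
      then show ?thesis using Ft flux_sgn(2) t by simp
    next
      case False
      have "\<alpha> < ereal x" using s x by (meson ereal_less_eq(3) less_le_trans)
      then show ?thesis using pos[of x] False x by simp
    qed
    ultimately show "\<exists>y. (u has_real_derivative y) (at x) \<and> y \<ge> 0" by blast
  qed (use s in simp)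
  then have "eventually (\<lambda>s. u s \<le> u t) (at_left_end \<alpha>)"
    using t tw' by (subst eventually_at_left_end[of _ \<beta>]) (auto simp: einterval_def)
  moreover have "(u \<longlongrightarrow> 1) (at_left_end \<alpha>)"
    using tw' by (simp add: filterlim_filtermap comp_def)
  moreover have "at_left_end \<alpha> \<noteq> bot" using tw' at_left_end_neq_bot by blast
  ultimately have "1 \<le> u t" by (intro tendsto_upperbound[of u 1])
  with range(2)[OF t] show False by simp
qed

lemma travelling_wave_imp_wave_equation:
  assumes sa: "standing_assumptions p f g \<rho> d" and tw: "travelling_wave p f g \<rho> d c \<alpha> \<beta> u"
  shows "wave_equation \<alpha> \<beta> u (deriv u) p (\<lambda>v. c * g v - f v) \<rho> d (\<lambda>t. - flux p d u t)"
proof -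
  note tw' = tw[unfolded travelling_wave_def]
  note sa' = sa[unfolded standing_assumptions_def]
  note u = C1_differentiable_on_deriv[of u "einterval \<alpha> \<beta>"]
  note F = C1_differentiable_on_deriv[of "flux p d u" "einterval \<alpha> \<beta>"]
  note dec = travelling_wave_decreasing[OF sa tw]
  show ?thesis
  proof
    show "\<alpha> < \<beta>" using tw' by blast
    show "(u has_real_derivative deriv u t) (at t)" if "t \<in> einterval \<alpha> \<beta>" for t
      using u(1) tw' that by blast
    show "continuous_on (einterval \<alpha> \<beta>) (deriv u)" using u(2) tw' by blast
    show "u t \<in> {0<..<1}" if "t \<in> einterval \<alpha> \<beta>" for t using tw' that by simp
    show "deriv u t < 0" if "t \<in> einterval \<alpha> \<beta>" for t using dec that .
    show "p > 1" using sa' by blast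
    show "\<rho> v > 0" "d v > 0" if "v \<in> {0<..<1}" for v using sa' that by blast+
    show "continuous_on {0..1} (\<lambda>v. c * g v - f v)" using sa' by (auto intro!: continuous_intros)
    show "continuous_on {0<..<1} \<rho>" using sa' by (auto intro: continuous_on_subset)
    show "continuous_on {0<..<1} d" using sa' C1_differentiable_imp_continuous_on by blast
    show "(u \<longlongrightarrow> 1) (at_left_end \<alpha>)" using tw' by (simp add: filterlim_filtermap comp_def)
    have "(flux p d u \<longlongrightarrow> 0) (at_left_end \<alpha>)" using tw' by (simp add: filterlim_filtermap comp_def)
    then show "((\<lambda>t. - flux p d u t) \<longlongrightarrow> 0) (at_left_end \<alpha>)" using tendsto_minus by fastforce
    fix t assume t: "t \<in> einterval \<alpha> \<beta>"
    show "- flux p d u t = d (u t) * (- deriv u t) powr (p - 1)"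
      using dec[OF t] powr_add[of "- deriv u t" "p - 2" 1] by (simp add: flux_def)
    have "deriv (flux p d u) t + (c * g (u t) - f (u t)) * deriv u t + \<rho> (u t) = 0"
      using tw' t by blast
    then have eq: "- deriv (flux p d u) t = (c * g (u t) - f (u t)) * deriv u t + \<rho> (u t)"
      by linarith
    have "(flux p d u has_real_derivative deriv (flux p d u) t) (at t)"
      using F(1) tw' t by blast
    then show "((\<lambda>t. - flux p d u t) has_real_derivative
        (c * g (u t) - f (u t)) * deriv u t + \<rho> (u t)) (at t)"
      unfolding eq[symmetric] by (rule DERIV_minus)
  qed
qed

section \<open>The criterion for a finite left end\<close>

theorem theorem17:
  fixes p c l :: real and f g \<rho> d u :: "real \<Rightarrow> real" and \<alpha> \<beta> :: ereal
  assumes "standing_assumptions p f g \<rho> d"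
    and "((\<lambda>v. \<rho> v * (d v / (1 - v)) powr (1 / (p - 1))) \<longlongrightarrow> l) (at_left 1)"
    and "travelling_wave p f g \<rho> d c \<alpha> \<beta> u"
    and "ereal c \<ge> minimal_speed p f g \<rho> d"
  shows
    "(l > 0 \<longrightarrow>
        (\<alpha> > -\<infinity> \<longleftrightarrow> (\<integral>\<^sup>+ v\<in>{1/2<..<1}. ennreal (1 / \<rho> v) \<partial>lborel) < \<infinity>)) \<and>
     (l = 0 \<and> c * g 1 - f 1 < 0 \<longrightarrow>
        (\<alpha> > -\<infinity> \<longleftrightarrow>
          (\<integral>\<^sup>+ v\<in>{1/2<..<1}. ennreal ((d v / (1 - v)) powr (1 / (p - 1))) \<partial>lborel) < \<infinity>)) \<and>
     (l = 0 \<and> c * g 1 - f 1 > 0 \<and> C1_comparable_near_1 p \<rho> d \<longrightarrow>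
        (\<alpha> > -\<infinity> \<longleftrightarrow> (\<integral>\<^sup>+ v\<in>{1/2<..<1}. ennreal (1 / \<rho> v) \<partial>lborel) < \<infinity>)) \<and>
     (l = 0 \<and> c * g 1 - f 1 = 0 \<and> C1_comparable_near_1 p \<rho> d \<longrightarrow>
        (\<integral>\<^sup>+ v\<in>{1/2<..<1}. ennreal (1 / \<rho> v) \<partial>lborel) < \<infinity> \<longrightarrow> \<alpha> > -\<infinity>)"
proof -
  \<comment> \<open>The drift \<open>h 1\<close> becomes \<open>c * g 1 - f 1\<close>, the quantity
    whose sign separates the cases with limit 0.\<close>
  interpret wave_equation \<alpha> \<beta> u "deriv u" p "\<lambda>v. c * g v - f v" \<rho> d "\<lambda>t. - flux p d u t"
    using assms(1,3) by (rule travelling_wave_imp_wave_equation)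
  show ?thesis
  proof (intro conjI impI)
    assume "l > 0"
    with assms(2) show "\<alpha> > -\<infinity> \<longleftrightarrow> (\<integral>\<^sup>+ v\<in>{1/2<..<1}. ennreal (1 / \<rho> v) \<partial>lborel) < \<infinity>"
      by (rule positive_limit_case)
  next
    assume "l = 0 \<and> c * g 1 - f 1 < 0"
    then show "\<alpha> > -\<infinity> \<longleftrightarrow>
        (\<integral>\<^sup>+ v\<in>{1/2<..<1}. ennreal ((d v / (1 - v)) powr (1 / (p - 1))) \<partial>lborel) < \<infinity>"
      by (intro negative_drift_case[OF assms(2)]) simp
  next
    assume *: "l = 0 \<and> c * g 1 - f 1 > 0 \<and> C1_comparable_near_1 p \<rho> d"
    with assms(2) have lim: "((\<lambda>v. \<rho> v * (d v / (1 - v)) powr (1 / (p - 1))) \<longlongrightarrow> 0) (at_left 1)"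
      by simp
    show "\<alpha> > -\<infinity> \<longleftrightarrow> (\<integral>\<^sup>+ v\<in>{1/2<..<1}. ennreal (1 / \<rho> v) \<partial>lborel) < \<infinity>"
      using comparable_case_left_end_finite[OF lim] positive_drift_nn_integral_finite[OF lim] *
      by (intro iffI) simp_all
  next
    assume *: "l = 0 \<and> c * g 1 - f 1 = 0 \<and> C1_comparable_near_1 p \<rho> d"
      and fin: "(\<integral>\<^sup>+ v\<in>{1/2<..<1}. ennreal (1 / \<rho> v) \<partial>lborel) < \<infinity>"
    show "\<alpha> > -\<infinity>"
      using assms(2) * by (intro comparable_case_left_end_finite fin) simp_all
  qed
qed

end
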